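(* Let $G$ be a graph with no isolated vertex and let $H$ be a nontrivial graph. (i) If $\gamma(H)=1$, then $\gamma_{\times 2}(G\circ H)\leq \gamma_{t\{R2\}}(G)$. (ii) If $H$ has at least two universal vertices, then $\gamma_{\times 2}(G\circ H)\leq 2\gamma(G)$. (iii) If $H$ has exactly one universal vertex, then $\gamma_{\times 2}(G\circ H)=\gamma_{t\{R2\}}(G)$. (iv) If $\gamma(H)\geq 2$, then $\gamma_{\times 2}(G\circ H)\geq \gamma_{t\{R2\}}(G)$.
   Context: All graphs are finite, undirected, without loops or multiple edges, and have at least one vertex; a graph is nontrivial if it has at least two vertices. $N(v)$ denotes the open neighbourhood of $v$. A universal vertex of a graph is a vertex adjacent to all other vertices. The lexicographic product $G\circ H$ has vertex set $V(G)\times V(H)$, and $(u,v)$ is adjacent to $(x,y)$ if and only if $ux\in E(G)$, or $u=x$ and $vy\in E(H)$. A vertex dominates itself and its neighbours. The domination number $\gamma(F)$ of a graph $F$ is the minimum cardinality of a set $S\subseteq V(F)$ such that every vertex of $F$ is dominated by at least one vertex of $S$. For a graph $F$ with no isolated vertex: $\gamma_{\times 2}(F)$ is the minimum cardinality of a double dominating set, i.e. a set $S\subseteq V(F)$ such that every vertex of $F$ is dominated by at least two vertices of $S$; a total dominating set is a set $S\subseteq V(F)$ such that every vertex of $F$ (including those in $S$) has a neighbour in $S$; $\gamma_{t\{R2\}}(F)$ is the minimum of $\sum_{v\in V(F)}f(v)$ over all total Roman $\{2\}$-dominating functions, i.e. functions $f:V(F)\to\{0,1,2\}$ such that $\{v: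 f(v)\ge 1\}$ is a total dominating set of $F$ and $\sum_{w\in N(v)}f(w)\ge 2$ for every $v$ with $f(v)=0$. *)

theory Defs
  imports "Graph_Theory.Pair_Digraph"
begin

text \<open>
  A finite simple undirected graph is a \<open>pair_graph\<close>: finitely many vertices \<open>pverts\<close> and a
  symmetric, irreflexive adjacency relation \<open>parcs\<close> on them. This locale admits the empty graph,
  so nonemptiness has to be assumed separately.
\<close>

definition open_neighbourhood :: "'a pair_pre_digraph \<Rightarrow> 'a \<Rightarrow> 'a set" where
  "open_neighbourhood F v = {w \<in> pverts F. (v, w) \<in> parcs F}"

definition has_isolated_vertex :: "'a pair_pre_digraph \<Rightarrow> bool" where
  "has_isolated_vertex F \<longleftrightarrow> (\<exists>v \<in> pverts F. open_neighbourhood F v = {})"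

definition universal_vertices :: "'a pair_pre_digraph \<Rightarrow> 'a set" where
  "universal_vertices F = {v \<in> pverts F. \<forall>w \<in> pverts F. w \<noteq> v \<longrightarrow> (v, w) \<in> parcs F}"

definition lexicographic_product ::
    "'a pair_pre_digraph \<Rightarrow> 'b pair_pre_digraph \<Rightarrow> ('a \<times> 'b) pair_pre_digraph" where
  "lexicographic_product G H =
     \<lparr> pverts = pverts G \<times> pverts H,
       parcs = {((u, v), (x, y)) | u v x y.
                  (u, v) \<in> pverts G \<times> pverts H \<and> (x, y) \<in> pverts G \<times> pverts H \<and>
                  ((u, x) \<in> parcs G \<or> u = x \<and> (v, y) \<in> parcs H)} \<rparr>"

(* Not called "dominates": Digraph uses that name for plain adjacency. *)
definition vertex_dominates :: "'a pair_pre_digraph \<Rightarrow> 'a \<Rightarrow> 'a \<Rightarrow> bool" where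
  "vertex_dominates F u v \<longleftrightarrow> v = u \<or> v \<in> open_neighbourhood F u"

definition dominating_set :: "'a pair_pre_digraph \<Rightarrow> 'a set \<Rightarrow> bool" where
  "dominating_set F S \<longleftrightarrow>
     S \<subseteq> pverts F \<and> (\<forall>v \<in> pverts F. \<exists>u \<in> S. vertex_dominates F u v)"

definition double_dominating_set :: "'a pair_pre_digraph \<Rightarrow> 'a set \<Rightarrow> bool" where
  "double_dominating_set F S \<longleftrightarrow>
     S \<subseteq> pverts F \<and> (\<forall>v \<in> pverts F. 2 \<le> card {u \<in> S. vertex_dominates F u v})"

definition total_dominating_set :: "'a pair_pre_digraph \<Rightarrow> 'a set \<Rightarrow> bool" where
  "total_dominating_set F S \<longleftrightarrow>
     S \<subseteq> pverts F \<and> (\<forall>v \<in> pverts F. \<exists>u \<in> S. u \<in> open_neighbourhood F v)"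

text \<open>Values of \<open>f\<close> outside \<open>pverts F\<close> are irrelevant, both here and for the weight of \<open>f\<close>.\<close>

definition total_roman2_dominating_function :: "'a pair_pre_digraph \<Rightarrow> ('a \<Rightarrow> nat) \<Rightarrow> bool" where
  "total_roman2_dominating_function F f \<longleftrightarrow>
     f ` pverts F \<subseteq> {0, 1, 2} \<and>
     total_dominating_set F {v \<in> pverts F. 1 \<le> f v} \<and>
     (\<forall>v \<in> pverts F. f v = 0 \<longrightarrow> 2 \<le> (\<Sum>w \<in> open_neighbourhood F v. f w))"

definition domination_number :: "'a pair_pre_digraph \<Rightarrow> nat" where
  "domination_number F = (LEAST k. \<exists>S. dominating_set F S \<and> card S = k)"

text \<open>
  The next two minima range over a nonempty set as soon as \<open>F\<close> is a graph without isolated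
  vertices; otherwise the values are meaningless.
\<close>

definition double_domination_number :: "'a pair_pre_digraph \<Rightarrow> nat" where
  "double_domination_number F = (LEAST k. \<exists>S. double_dominating_set F S \<and> card S = k)"

definition total_roman2_domination_number :: "'a pair_pre_digraph \<Rightarrow> nat" where
  "total_roman2_domination_number F =
     (LEAST k. \<exists>f. total_roman2_dominating_function F f \<and> (\<Sum>v \<in> pverts F. f v) = k)"

lemma pair_graph_lexicographic_product:
  assumes "pair_graph G" "pair_graph H"
  shows "pair_graph (lexicographic_product G H)"
proof -
  interpret G: pair_graph G by fact
  interpret H: pair_graph H by fact
  let ?P = "lexicographic_product G H"
  have "parcs ?P \<subseteq> (pverts G \<times> pverts H) \<times> (pverts G \<times> pverts H)"
    by (auto simp: lexicographic_product_def)
  then have "finite (parcs ?P)"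
    by (rule finite_subset) (simp add: G.pair_finite_verts H.pair_finite_verts)
  moreover have "sym (parcs ?P)"
    by (rule symI) (auto simp: lexicographic_product_def dest: G.arcs_symmetric H.arcs_symmetric)
  ultimately show ?thesis
    by unfold_locales
      (auto simp: lexicographic_product_def symmetric_def G.pair_finite_verts H.pair_finite_verts
        dest: G.no_loops' H.no_loops')
qed

lemma no_isolated_vertex_lexicographic_product:
  assumes "\<not> has_isolated_vertex G"
  shows "\<not> has_isolated_vertex (lexicographic_product G H)"
  using assms
  by (fastforce simp: has_isolated_vertex_def open_neighbourhood_def lexicographic_product_def)

lemma double_dominating_set_pverts:
  assumes "pair_graph F" "\<not> has_isolated_vertex F"
  shows "double_dominating_set F (pverts F)"
  unfolding double_dominating_set_def
proof (intro conjI ballI subset_refl)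
  interpret pair_graph F by fact
  fix v assume v: "v \<in> pverts F"
  then obtain w where w: "w \<in> pverts F" "(v, w) \<in> parcs F"
    using assms(2) by (auto simp: has_isolated_vertex_def open_neighbourhood_def)
  have "w \<noteq> v" using w no_loops' by blast
  have "card {v, w} \<le> card {u \<in> pverts F. vertex_dominates F u v}"
    using v w by (intro card_mono)
      (auto simp: pair_finite_verts vertex_dominates_def open_neighbourhood_def
        dest: arcs_symmetric)
  then show "2 \<le> card {u \<in> pverts F. vertex_dominates F u v}"
    using \<open>w \<noteq> v\<close> by simp
qed

lemma total_roman2_dominating_function_const_2:
  assumes "\<not> has_isolated_vertex F"
  shows "total_roman2_dominating_function F (\<lambda>_. 2)"
  using assms
  by (fastforce simp: total_roman2_dominating_function_def total_dominating_set_def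
      has_isolated_vertex_def open_neighbourhood_def)

end

theory Submission
  imports Defs
begin

text \<open>
  A subset of the product is a family of columns \<open>C u \<subseteq> V(H)\<close>, \<open>u \<in> V(G)\<close>, and \<open>(x, y)\<close> is dominated
  by the whole columns over the neighbours of \<open>x\<close> and by the dominators of \<open>y\<close> in \<open>C x\<close>. For the upper
  bounds, take columns of size \<open>f u\<close> that contain a universal vertex of \<open>H\<close> whenever \<open>f u > 0\<close>. For
  the lower bound, \<open>u \<mapsto> min 2 (card (C u))\<close> fails to be a total Roman function only at vertices
  \<open>u\<close> whose neighbours all have an empty column. There \<open>C u\<close> is a double dominating set of \<open>H\<close>. Such
  a set with only two elements would consist of universal vertices, so \<open>C u\<close> has at least three
  elements when \<open>H\<close> has at most one universal vertex, and the element lost by truncation pays for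
  the value 1 on some neighbour of \<open>u\<close>.
\<close>

section \<open>Counting dominators in the product column by column\<close>

text \<open>Adjacency over an edge of \<open>G\<close> ignores the \<open>H\<close>-coordinate,
  hence whole columns in the sum. Since \<open>G\<close> has no loops, the column over
  \<open>x\<close> is not among them and the two counts add up.\<close>

lemma card_dominators_Sigma:
  assumes "pair_graph G" "pair_graph H"
    and C: "\<And>u. u \<in> pverts G \<Longrightarrow> C u \<subseteq> pverts H"
    and x: "x \<in> pverts G" and y: "y \<in> pverts H"
  shows "card {p \<in> Sigma (pverts G) C. vertex_dominates (lexicographic_product G H) p (x, y)}
       = (\<Sum>u\<in>open_neighbourhood G x. card (C u)) + card {z \<in> C x. vertex_dominates H z y}"
proof -
  interpret G: pair_graph G by fact
  interpret H: pair_graph H by fact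
  have finC: "finite (C u)" if "u \<in> pverts G" for u
    using C[OF that] H.pair_finite_verts finite_subset by blast
  have finN: "finite (open_neighbourhood G x)"
    by (simp add: open_neighbourhood_def G.pair_finite_verts)
  have "{p \<in> Sigma (pverts G) C. vertex_dominates (lexicographic_product G H) p (x, y)}
      = Sigma (open_neighbourhood G x) C \<union> {x} \<times> {z \<in> C x. vertex_dominates H z y}"
  proof (rule set_eqI, clarify)
    fix u z
    have "(u, z) \<in> Sigma (pverts G) C \<Longrightarrow> u \<in> pverts G \<and> z \<in> pverts H"
      using C by blast
    moreover have "(u, x) \<in> parcs G \<longleftrightarrow> (x, u) \<in> parcs G"
      using G.arcs_symmetric by blast
    ultimately show "(u, z) \<in> {p \<in> Sigma (pverts G) C.
          vertex_dominates (lexicographic_product G H) p (x, y)} \<longleftrightarrow>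
        (u, z) \<in> Sigma (open_neighbourhood G x) C \<union> {x} \<times> {z \<in> C x. vertex_dominates H z y}"
      using x y
      by (auto simp: vertex_dominates_def open_neighbourhood_def lexicographic_product_def)
  qed
  moreover have "Sigma (open_neighbourhood G x) C \<inter> {x} \<times> {z \<in> C x. vertex_dominates H z y} = {}"
    using G.no_loops' by (auto simp: open_neighbourhood_def)
  moreover have "finite (Sigma (open_neighbourhood G x) C)"
    using finN finC by (auto simp: open_neighbourhood_def intro!: finite_SigmaI)
  moreover have "card (Sigma (open_neighbourhood G x) C) = (\<Sum>u\<in>open_neighbourhood G x. card (C u))"
    using finN finC by (auto simp: open_neighbourhood_def intro!: card_SigmaI)
  ultimately show ?thesis
    using finC[OF x] by (simp add: card_Un_disjoint card_cartesian_product_singleton)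
qed

text \<open>Turns double domination into a numerical condition on columns: the upper bounds use it
  to verify a construction, the lower bound to read off constraints from a minimum set.\<close>

lemma double_dominating_set_lexicographic_product_Sigma:
  assumes "pair_graph G" "pair_graph H"
    and C: "\<And>u. u \<in> pverts G \<Longrightarrow> C u \<subseteq> pverts H"
  shows "double_dominating_set (lexicographic_product G H) (Sigma (pverts G) C) \<longleftrightarrow>
    (\<forall>x\<in>pverts G. \<forall>y\<in>pverts H.
      2 \<le> (\<Sum>u\<in>open_neighbourhood G x. card (C u)) + card {z \<in> C x. vertex_dominates H z y})"
proof -
  have V: "pverts (lexicographic_product G H) = pverts G \<times> pverts H"
    by (simp add: lexicographic_product_def)
  have "Sigma (pverts G) C \<subseteq> pverts G \<times> pverts H"
    using C by blast
  then show ?thesis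
    unfolding double_dominating_set_def V
    using card_dominators_Sigma[OF assms(1,2), of C] C by simp
qed

lemma double_domination_number_le:
  "double_dominating_set F S \<Longrightarrow> double_domination_number F \<le> card S"
  unfolding double_domination_number_def by (rule Least_le) blast

lemma total_roman2_domination_number_le:
  "total_roman2_dominating_function F f \<Longrightarrow>
    total_roman2_domination_number F \<le> (\<Sum>v\<in>pverts F. f v)"
  unfolding total_roman2_domination_number_def by (rule Least_le) blast

lemma double_domination_number_witness:
  assumes "double_dominating_set F S"
  obtains T where "double_dominating_set F T" "card T = double_domination_number F"
proof -
  have "\<exists>T. double_dominating_set F T \<and> card T = double_domination_number F"
    unfolding double_domination_number_def by (rule LeastI_ex) (use assms in blast)
  then show ?thesis using that by blast
qed

lemma total_roman2_domination_number_witness: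
  assumes "\<not> has_isolated_vertex F"
  obtains f where "total_roman2_dominating_function F f"
    "(\<Sum>v\<in>pverts F. f v) = total_roman2_domination_number F"
proof -
  have "\<exists>f. total_roman2_dominating_function F f \<and>
      (\<Sum>v\<in>pverts F. f v) = total_roman2_domination_number F"
    unfolding total_roman2_domination_number_def
    by (rule LeastI_ex) (use total_roman2_dominating_function_const_2[OF assms] in blast)
  then show ?thesis using that by blast
qed

lemma domination_number_witness:
  obtains D where "dominating_set F D" "card D = domination_number F"
proof -
  have pverts: "dominating_set F (pverts F)"
    by (auto simp: dominating_set_def vertex_dominates_def)
  have "\<exists>D. dominating_set F D \<and> card D = domination_number F"
    unfolding domination_number_def by (rule LeastI_ex) (use pverts in blast)
  then show ?thesis using that by blast
qed

section \<open>Universal vertices and the domination number\<close>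

lemma universal_vertices_iff:
  "v \<in> universal_vertices F \<longleftrightarrow> v \<in> pverts F \<and> (\<forall>w\<in>pverts F. vertex_dominates F v w)"
  by (auto simp: universal_vertices_def vertex_dominates_def open_neighbourhood_def)

lemma universal_vertex_of_domination_number_1:
  assumes "domination_number H = 1"
  shows "universal_vertices H \<noteq> {}"
proof -
  obtain D where "dominating_set H D" "card D = 1"
    using domination_number_witness[of H] assms by metis
  moreover then obtain v where "D = {v}" by (auto simp: card_1_singleton_iff)
  ultimately have "v \<in> universal_vertices H"
    by (auto simp: dominating_set_def universal_vertices_iff)
  then show ?thesis by blast
qed

text \<open>Used contrapositively: it places the case \<gamma>(H) \<ge> 2 under the lower bound, as
  \<open>H\<close> then has no universal vertex.\<close>

lemma domination_number_le_1:
  assumes "v \<in> universal_vertices H"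
  shows "domination_number H \<le> 1"
proof -
  have "dominating_set H {v}"
    using assms by (auto simp: dominating_set_def universal_vertices_iff)
  moreover have "card {v} = 1" by simp
  ultimately show ?thesis
    unfolding domination_number_def by (intro Least_le) blast
qed

section \<open>Upper bounds by constructing columns\<close>

text \<open>Over a vertex of value 0, the Roman condition supplies two dominators from neighbouring
  columns. Over any other vertex, \<open>v\<close> in its own column is one dominator and total
  domination supplies another.\<close>

lemma double_domination_number_lexicographic_product_le_roman:
  assumes "pair_graph G" "\<not> has_isolated_vertex G" "pair_graph H" "2 \<le> card (pverts H)"
    and v: "v \<in> universal_vertices H"
  shows "double_domination_number (lexicographic_product G H) \<le> total_roman2_domination_number G"
proof -
  interpret G: pair_graph G by fact
  interpret H: pair_graph H by fact
  obtain f where f: "total_roman2_dominating_function G f"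
    and weight: "(\<Sum>u\<in>pverts G. f u) = total_roman2_domination_number G"
    using total_roman2_domination_number_witness[OF assms(2)] by blast
  have vH: "v \<in> pverts H" and dom: "\<And>y. y \<in> pverts H \<Longrightarrow> vertex_dominates H v y"
    using v by (auto simp: universal_vertices_iff)
  \<comment> \<open>\<open>w\<close> only brings a column up to size 2; inside a column
    \<open>v\<close> does the dominating.\<close>
  obtain w where w: "w \<in> pverts H" "w \<noteq> v"
  proof -
    have "\<not> pverts H \<subseteq> {v}"
      using assms(4) card_mono[of "{v}" "pverts H"] by auto
    then show ?thesis using that by blast
  qed
  define C where "C u = (if f u = 0 then {} else if f u = 1 then {v} else {v, w})" for u
  have f2: "f u = 0 \<or> f u = 1 \<or> f u = 2" if "u \<in> pverts G" for u
    using f that by (auto simp: total_roman2_dominating_function_def)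
  have cardC: "card (C u) = f u" if "u \<in> pverts G" for u
    using f2[OF that] w by (auto simp: C_def)
  have CH: "C u \<subseteq> pverts H" for u
    using vH w by (auto simp: C_def)
  have finC: "finite (C u)" for u by (simp add: C_def)
  have sumC: "(\<Sum>u\<in>open_neighbourhood G x. card (C u)) = (\<Sum>u\<in>open_neighbourhood G x. f u)" for x
    by (rule sum.cong) (auto simp: cardC open_neighbourhood_def)
  have "double_dominating_set (lexicographic_product G H) (Sigma (pverts G) C)"
    unfolding double_dominating_set_lexicographic_product_Sigma[OF assms(1,3) CH] sumC
  proof (intro ballI)
    fix x y assume x: "x \<in> pverts G" and y: "y \<in> pverts H"
    show "2 \<le> (\<Sum>u\<in>open_neighbourhood G x. f u) + card {z \<in> C x. vertex_dominates H z y}"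
    proof (cases "f x = 0")
      case True
      then show ?thesis
        using f x by (auto simp: total_roman2_dominating_function_def intro: trans_le_add1)
    next
      case False
      obtain u where u: "u \<in> open_neighbourhood G x" "1 \<le> f u"
        using f x
        by (auto simp: total_roman2_dominating_function_def total_dominating_set_def)
      have "f u \<le> (\<Sum>u\<in>open_neighbourhood G x. f u)"
        using u by (intro member_le_sum) (auto simp: open_neighbourhood_def G.pair_finite_verts)
      moreover have "card {v} \<le> card {z \<in> C x. vertex_dominates H z y}"
        using False dom[OF y] finC by (intro card_mono) (auto simp: C_def)
      ultimately show ?thesis using u by simp
    qed
  qed
  then have "double_domination_number (lexicographic_product G H) \<le> card (Sigma (pverts G) C)"
    by (rule double_domination_number_le)
  also have "\<dots> = (\<Sum>u\<in>pverts G. f u)"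
    using finC G.pair_finite_verts by (simp add: card_SigmaI cardC)
  finally show ?thesis using weight by simp
qed

text \<open>Two universal vertices of \<open>H\<close> over each vertex of a minimum dominating set
  of \<open>G\<close> dominate both their own column and all neighbouring ones twice.\<close>

lemma double_domination_number_lexicographic_product_le_domination:
  assumes "pair_graph G" "pair_graph H"
    and two: "2 \<le> card (universal_vertices H)"
  shows "double_domination_number (lexicographic_product G H) \<le> 2 * domination_number G"
proof -
  interpret G: pair_graph G by fact
  interpret H: pair_graph H by fact
  obtain D where D: "dominating_set G D" and cardD: "card D = domination_number G"
    using domination_number_witness by blast
  have DG: "D \<subseteq> pverts G" using D by (simp add: dominating_set_def)
  obtain U where U: "U \<subseteq> universal_vertices H" "card U = 2" "finite U"
    using obtain_subset_with_card_n[OF two] by blast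
  define C where "C u = (if u \<in> D then U else {})" for u
  have CH: "C u \<subseteq> pverts H" for u
    using U by (auto simp: C_def universal_vertices_def)
  have "double_dominating_set (lexicographic_product G H) (Sigma (pverts G) C)"
    unfolding double_dominating_set_lexicographic_product_Sigma[OF assms(1,2) CH]
  proof (intro ballI)
    fix x y assume x: "x \<in> pverts G" and y: "y \<in> pverts H"
    show "2 \<le> (\<Sum>u\<in>open_neighbourhood G x. card (C u)) + card {z \<in> C x. vertex_dominates H z y}"
    proof (cases "x \<in> D")
      case True
      then have "{z \<in> C x. vertex_dominates H z y} = U"
        using U y by (auto simp: C_def universal_vertices_iff)
      then show ?thesis using U by simp
    next
      case False
      then obtain u where u: "u \<in> D" "x \<in> open_neighbourhood G u"
        using D x by (auto simp: dominating_set_def vertex_dominates_def)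
      then have "u \<in> open_neighbourhood G x"
        using DG by (auto simp: open_neighbourhood_def dest: G.arcs_symmetric)
      then have "card (C u) \<le> (\<Sum>u\<in>open_neighbourhood G x. card (C u))"
        by (intro member_le_sum) (auto simp: open_neighbourhood_def G.pair_finite_verts)
      then show ?thesis using u U by (simp add: C_def)
    qed
  qed
  then have "double_domination_number (lexicographic_product G H) \<le> card (Sigma (pverts G) C)"
    by (rule double_domination_number_le)
  also have "Sigma (pverts G) C = D \<times> U"
    using DG by (auto simp: C_def split: if_splits)
  finally show ?thesis using U cardD by (simp add: card_cartesian_product)
qed

section \<open>Lower bound by truncating columns\<close>

lemma card_double_dominating_set_ge_3:
  assumes "pair_graph H" "pverts H \<noteq> {}" "card (universal_vertices H) \<le> 1"
    and S: "double_dominating_set H S"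
  shows "3 \<le> card S"
proof (rule ccontr)
  interpret H: pair_graph H by fact
  assume "\<not> 3 \<le> card S"
  have SH: "S \<subseteq> pverts H" using S by (simp add: double_dominating_set_def)
  then have finS: "finite S" using H.pair_finite_verts finite_subset by blast
  have le: "2 \<le> card {u \<in> S. vertex_dominates H u y}" if "y \<in> pverts H" for y
    using S that by (simp add: double_dominating_set_def)
  \<comment> \<open>At least two dominators of \<open>y\<close> inside a set of at most two elements
    must be the entire set.\<close>
  have all: "{u \<in> S. vertex_dominates H u y} = S" if "y \<in> pverts H" for y
    using finS le[OF that] \<open>\<not> 3 \<le> card S\<close> by (intro card_seteq) auto
  then have "S \<subseteq> universal_vertices H"
    using SH unfolding universal_vertices_iff subset_iff by blast
  then have "card S \<le> card (universal_vertices H)"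
    by (intro card_mono) (auto simp: universal_vertices_def H.pair_finite_verts)
  moreover have "2 \<le> card S" using assms(2) le all by fastforce
  ultimately show False using assms(3) by simp
qed

text \<open>The bound on universal vertices covers both (iii), with exactly one, and (iv), with
  none.\<close>

lemma total_roman2_domination_number_le_lexicographic_product:
  assumes "pair_graph G" "\<not> has_isolated_vertex G" "pair_graph H" "pverts H \<noteq> {}"
    and univ: "card (universal_vertices H) \<le> 1"
  shows "total_roman2_domination_number G \<le> double_domination_number (lexicographic_product G H)"
proof -
  interpret G: pair_graph G by fact
  interpret H: pair_graph H by fact
  obtain S where S: "double_dominating_set (lexicographic_product G H) S"
    and cardS: "card S = double_domination_number (lexicographic_product G H)"
    using double_domination_number_witness[OF double_dominating_set_pverts[OF
          pair_graph_lexicographic_product[OF assms(1,3)]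
          no_isolated_vertex_lexicographic_product[OF assms(2)]]] by blast
  define C where "C u = {y. (u, y) \<in> S}" for u
  have SV: "S \<subseteq> pverts G \<times> pverts H"
    using S by (simp add: double_dominating_set_def lexicographic_product_def)
  then have SC: "S = Sigma (pverts G) C" and CH: "\<And>u. C u \<subseteq> pverts H"
    by (auto simp: C_def)
  have finC: "finite (C u)" for u using CH H.pair_finite_verts finite_subset by blast
  have finN: "finite (open_neighbourhood G x)" for x
    by (simp add: open_neighbourhood_def G.pair_finite_verts)
  have dd: "2 \<le> (\<Sum>u\<in>open_neighbourhood G x. card (C u)) + card {z \<in> C x. vertex_dominates H z y}"
    if "x \<in> pverts G" "y \<in> pverts H" for x y
    using S that unfolding SC double_dominating_set_lexicographic_product_Sigma[OF assms(1,3) CH]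
    by blast
  \<comment> \<open>\<open>B\<close> holds the vertices where truncated column sizes violate total
    domination; vertices with an empty column are settled by \<open>empty_sum\<close>.\<close>
  define B where "B = {u \<in> pverts G. C u \<noteq> {} \<and> (\<forall>x\<in>open_neighbourhood G u. C x = {})}"
  have finB: "finite B" by (simp add: B_def G.pair_finite_verts)
  \<comment> \<open>The neighbouring columns contribute nothing in \<open>dd\<close>, so
    \<open>C u\<close> must double dominate \<open>H\<close> on its own.\<close>
  have B3: "3 \<le> card (C u)" if "u \<in> B" for u
  proof (rule card_double_dominating_set_ge_3[OF assms(3,4) univ])
    show "double_dominating_set H (C u)"
      using that dd[of u] CH by (auto simp: double_dominating_set_def B_def)
  qed
  have "\<forall>u\<in>pverts G. \<exists>x. x \<in> open_neighbourhood G u"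
    using assms(2) by (auto simp: has_isolated_vertex_def)
  then obtain n where n: "\<And>u. u \<in> pverts G \<Longrightarrow> n u \<in> open_neighbourhood G u"
    by metis
  define g where "g u = min 2 (card (C u))" for u
  \<comment> \<open>The chosen neighbours \<open>n u\<close> of vertices in \<open>B\<close> are
    raised to at least 1; taking \<open>max\<close> instead of a sum keeps values at most 2.\<close>
  define f where "f u = max (g u) (if u \<in> n ` B then 1 else 0)" for u
  have f_pos: "1 \<le> f u" if "C u \<noteq> {} \<or> u \<in> n ` B" for u
    using that finC[of u] card_gt_0_iff[of "C u"] by (auto simp: f_def g_def)
  \<comment> \<open>Truncation at 2 is harmless here: either one neighbouring column already
    contributes 2, or no neighbouring column is shortened.\<close>
  have empty_sum: "2 \<le> (\<Sum>w\<in>open_neighbourhood G x. g w)" if x: "x \<in> pverts G" "C x = {}" for x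
  proof -
    obtain y where "y \<in> pverts H" using assms(4) by blast
    then have two: "2 \<le> (\<Sum>w\<in>open_neighbourhood G x. card (C w))"
      using dd[of x y] x by simp
    show ?thesis
    proof (cases "\<exists>w\<in>open_neighbourhood G x. 2 \<le> card (C w)")
      case True
      then obtain w where w: "w \<in> open_neighbourhood G x" "g w = 2"
        by (auto simp: g_def min_def)
      have "g w \<le> (\<Sum>w\<in>open_neighbourhood G x. g w)"
        using w finN by (intro member_le_sum) auto
      then show ?thesis using w by simp
    next
      case False
      then have "(\<Sum>w\<in>open_neighbourhood G x. g w) = (\<Sum>w\<in>open_neighbourhood G x. card (C w))"
        by (intro sum.cong) (auto simp: g_def min_def)
      then show ?thesis using two by simp
    qed
  qed
  have "total_roman2_dominating_function G f"
    unfolding total_roman2_dominating_function_def total_dominating_set_def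
  proof (intro conjI ballI impI)
    show "f ` pverts G \<subseteq> {0, 1, 2}" by (auto simp: f_def g_def)
    show "{v \<in> pverts G. 1 \<le> f v} \<subseteq> pverts G" by blast
  next
    fix x assume x: "x \<in> pverts G"
    have "\<exists>u\<in>open_neighbourhood G x. C u \<noteq> {} \<or> u \<in> n ` B"
    proof (cases "C x = {}")
      case True
      show ?thesis
      proof (rule ccontr)
        assume "\<not> ?thesis"
        then have "(\<Sum>w\<in>open_neighbourhood G x. g w) = 0" by (simp add: g_def)
        then show False using empty_sum[OF x True] by simp
      qed
    next
      case False
      then show ?thesis using x n[OF x] by (cases "x \<in> B") (auto simp: B_def)
    qed
    then show "\<exists>u\<in>{v \<in> pverts G. 1 \<le> f v}. u \<in> open_neighbourhood G x"
      using f_pos by (auto simp: open_neighbourhood_def)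
  next
    fix x assume x: "x \<in> pverts G" and "f x = 0"
    then have "C x = {}" using f_pos[of x] by fastforce
    then have "2 \<le> (\<Sum>w\<in>open_neighbourhood G x. g w)" by (rule empty_sum[OF x])
    also have "\<dots> \<le> (\<Sum>w\<in>open_neighbourhood G x. f w)"
      by (rule sum_mono) (simp add: f_def)
    finally show "2 \<le> (\<Sum>w\<in>open_neighbourhood G x. f w)" .
  qed
  then have "total_roman2_domination_number G \<le> (\<Sum>u\<in>pverts G. f u)"
    by (rule total_roman2_domination_number_le)
  also have "\<dots> \<le> (\<Sum>u\<in>pverts G. g u + (if u \<in> n ` B then 1 else 0))"
    by (rule sum_mono) (simp add: f_def)
  also have "\<dots> = (\<Sum>u\<in>pverts G. g u) + card (pverts G \<inter> n ` B)"
    using G.pair_finite_verts by (simp add: sum.distrib sum.If_cases Int_def)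
  also have "card (pverts G \<inter> n ` B) \<le> card (n ` B)"
    using finB by (intro card_mono) auto
  \<comment> \<open>Several vertices of \<open>B\<close> may share a chosen neighbour, which only
    lowers the cost.\<close>
  also have "\<dots> \<le> card B" by (rule card_image_le[OF finB])
  also have "card B = (\<Sum>u\<in>pverts G. if u \<in> B then 1 else 0)"
    using G.pair_finite_verts by (simp add: sum.If_cases Int_def B_def conj_ac)
  also have "(\<Sum>u\<in>pverts G. g u) + \<dots> = (\<Sum>u\<in>pverts G. g u + (if u \<in> B then 1 else 0))"
    by (simp add: sum.distrib)
  \<comment> \<open>The cost is now charged to \<open>B\<close> itself, so terms compare pointwise:
    on \<open>B\<close> the left term is 2 + 1, at most the column size by
    \<open>B3\<close>.\<close>
  also have "\<dots> \<le> (\<Sum>u\<in>pverts G. card (C u))"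
    using B3 by (intro sum_mono) (fastforce simp: g_def min_def)
  also have "\<dots> = card S"
    unfolding SC using finC G.pair_finite_verts by (simp add: card_SigmaI)
  finally show ?thesis using cardS by simp
qed

theorem theorem2p7:
  fixes G :: "'a pair_pre_digraph" and H :: "'b pair_pre_digraph"
  assumes "pair_graph G" and "pverts G \<noteq> {}" and "\<not> has_isolated_vertex G"
    and "pair_graph H" and "2 \<le> card (pverts H)"
  shows
    "(domination_number H = 1 \<longrightarrow>
        double_domination_number (lexicographic_product G H) \<le> total_roman2_domination_number G) \<and>
     (2 \<le> card (universal_vertices H) \<longrightarrow>
        double_domination_number (lexicographic_product G H) \<le> 2 * domination_number G) \<and>
     (card (universal_vertices H) = 1 \<longrightarrow>
        double_domination_number (lexicographic_product G H) = total_roman2_domination_number G) \<and>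
     (2 \<le> domination_number H \<longrightarrow>
        total_roman2_domination_number G \<le> double_domination_number (lexicographic_product G H))"
proof -
  have ne: "pverts H \<noteq> {}" using assms(5) by auto
  have one: "\<exists>v. v \<in> universal_vertices H" if "card (universal_vertices H) = 1"
    using that by (auto simp: card_1_singleton_iff)
  have none: "universal_vertices H = {}" if "2 \<le> domination_number H"
    using domination_number_le_1[of _ H] that by fastforce
  note upper = double_domination_number_lexicographic_product_le_roman[OF assms(1,3,4,5)]
  note lower = total_roman2_domination_number_le_lexicographic_product[OF assms(1,3,4) ne]
  show ?thesis
    using upper lower one none universal_vertex_of_domination_number_1[of H]
      double_domination_number_lexicographic_product_le_domination[OF assms(1,4)]
    by (intro conjI impI antisym) auto
qed

end
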